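(* Let $\mathbb A$ be an algebra on $\mathbb R^3$ with unit $e$ and structure constants $c_{ijk}$, and let $F$ be an $\mathbb A$-algebrizable vector field defined on an open set $\Omega\subset\mathbb R^3$. Then $$\int_\gamma\frac eF\,d\xi=\left(\int_\gamma G_1\cdot ds,\int_\gamma G_2\cdot ds,\int_\gamma G_3\cdot ds\right)$$ for every differentiable curve $\gamma$ contained in $\Omega(F,\mathbb A^* )$. Here $G_1,G_2,G_3$ are conservative (gradient) vector fields given by $$G_k=\sum_{j=1}^3\sum_{i=1}^3c_{ijk}\,g_i\,e_j,\qquad k=1,2,3,$$ where $g_1,g_2,g_3$ satisfy $(g_1,g_2,g_3)=\frac eF$. Thus, for $k=1,2,3$, $$G_k=(c_{11k}g_1+c_{21k}g_2+c_{31k}g_3,\ c_{12k}g_1+c_{22k}g_2+c_{32k}g_3,\ c_{13k}g_1+c_{23k}g_2+c_{33k}g_3).$$ Moreover, $\langle E_i,G_j\rangle=\delta_{ij}$ for $i,j\in\{1,2,3\}$, where $\delta_{ij}$ denotes the Kronecker delta and $E_i=e_iF$ is the $\mathbb A$-product of $e_i$ and $F$.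
   Context: An algebra $\mathbb A$ on $\mathbb R^3$ is the linear space $\mathbb R^3$ (canonical basis $e_1,e_2,e_3$) endowed with a bilinear, associative, commutative product with unit $e$; its structure constants are defined by $e_ie_j=\sum_{k=1}^3c_{ijk}e_k$. $\mathbb A^*$ is the set of regular (invertible) elements; the inverse of $a$ is written $\frac ea$. A vector field $F:\Omega\to\mathbb R^3$, $\Omega\subset\mathbb R^3$ open, is $\mathbb A$-algebrizable if there is $F':\Omega\to\mathbb R^3$ with $\lim_{\xi\to0}|F(w+\xi)-F(w)-F'(w)\xi|/|\xi|=0$ for all $w\in\Omega$ (product in $\mathbb A$). $\Omega(F,\mathbb A^* )=F^{-1}(\mathbb A^* )$, and $\frac eF$ is the function $w\mapsto F(w)^{-1}$ on it. For a differentiable curve $\gamma:[0,a]\to\Omega(F,\mathbb A^* )$, $\int_\gamma\frac eF\,d\xi=\int_0^a\frac e{F(\gamma(t))}\dot\gamma(t)\,dt$ (product in $\mathbb A$) and $\int_\gamma G\cdot ds=\int_0^a\langle G(\gamma(t)),\dot\gamma(t)\rangle\,dt$, with $\langle\cdot,\cdot\rangle$ the usual inner product of $\mathbb R^3$.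
   Formalization: "Conservative (gradient)" is proved as: each G_k has a potential on every simply connected open subset of Ω(F,A* ); a potential on all of Ω(F,A* ) need not exist (A = C×R, F(z,t) = (z,1) gives G_2 = dθ on z ≠ 0). *)

theory Defs
  imports "HOL-Analysis.Analysis"
begin

definition r3_algebra :: "(real^3 \<Rightarrow> real^3 \<Rightarrow> real^3) \<Rightarrow> real^3 \<Rightarrow> bool" where
  "r3_algebra mul e \<longleftrightarrow>
     bilinear mul \<and>
     (\<forall>x y z. mul (mul x y) z = mul x (mul y z)) \<and>
     (\<forall>x y. mul x y = mul y x) \<and>
     (\<forall>x. mul e x = x)"

definition structure_constants ::
    "(real^3 \<Rightarrow> real^3 \<Rightarrow> real^3) \<Rightarrow> (3 \<Rightarrow> 3 \<Rightarrow> 3 \<Rightarrow> real) \<Rightarrow> bool" where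
  "structure_constants mul c \<longleftrightarrow>
     (\<forall>i j. mul (axis i 1) (axis j 1) = (\<Sum>k\<in>UNIV. c i j k *\<^sub>R axis k 1))"

definition regular_elements :: "(real^3 \<Rightarrow> real^3 \<Rightarrow> real^3) \<Rightarrow> real^3 \<Rightarrow> (real^3) set" where
  "regular_elements mul e = {a. \<exists>b. mul a b = e}"

text \<open>Only meaningful on \<open>regular_elements mul e\<close>, where the inverse is unique.\<close>
definition alg_inverse :: "(real^3 \<Rightarrow> real^3 \<Rightarrow> real^3) \<Rightarrow> real^3 \<Rightarrow> real^3 \<Rightarrow> real^3" where
  "alg_inverse mul e a = (THE b. mul a b = e)"

text \<open>Intended for open \<open>\<Omega>\<close>; the values of the total function \<open>F\<close> outside \<open>\<Omega>\<close> are then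
  irrelevant to the limit.\<close>
definition algebrizable_on ::
    "(real^3 \<Rightarrow> real^3 \<Rightarrow> real^3) \<Rightarrow> (real^3) set \<Rightarrow> (real^3 \<Rightarrow> real^3) \<Rightarrow> bool" where
  "algebrizable_on mul \<Omega> F \<longleftrightarrow>
     (\<exists>F' :: real^3 \<Rightarrow> real^3. \<forall>w\<in>\<Omega>.
        ((\<lambda>\<xi>. norm (F (w + \<xi>) - F w - mul (F' w) \<xi>) / norm \<xi>) \<longlongrightarrow> 0) (at 0))"

definition regular_domain ::
    "(real^3 \<Rightarrow> real^3 \<Rightarrow> real^3) \<Rightarrow> real^3 \<Rightarrow> (real^3) set \<Rightarrow> (real^3 \<Rightarrow> real^3) \<Rightarrow> (real^3) set" where
  "regular_domain mul e \<Omega> F = {w \<in> \<Omega>. F w \<in> regular_elements mul e}"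

text \<open>Curves are parametrised by \<open>{0..a}\<close> and differentiable there (one-sidedly at the end points).
  Since the velocity need not be continuous, integrals are Henstock--Kurzweil integrals, which
  agree with Riemann integrals whenever the latter exist.\<close>

definition alg_line_integrand ::
    "(real^3 \<Rightarrow> real^3 \<Rightarrow> real^3) \<Rightarrow> (real^3 \<Rightarrow> real^3) \<Rightarrow> real \<Rightarrow> (real \<Rightarrow> real^3) \<Rightarrow> real \<Rightarrow> real^3" where
  "alg_line_integrand mul H a \<gamma> t =
     mul (H (\<gamma> t)) (vector_derivative \<gamma> (at t within {0..a}))"

definition alg_line_integral ::
    "(real^3 \<Rightarrow> real^3 \<Rightarrow> real^3) \<Rightarrow> (real^3 \<Rightarrow> real^3) \<Rightarrow> real \<Rightarrow> (real \<Rightarrow> real^3) \<Rightarrow> real^3" where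
  "alg_line_integral mul H a \<gamma> = integral {0..a} (alg_line_integrand mul H a \<gamma>)"

definition line_integrand ::
    "(real^3 \<Rightarrow> real^3) \<Rightarrow> real \<Rightarrow> (real \<Rightarrow> real^3) \<Rightarrow> real \<Rightarrow> real" where
  "line_integrand G a \<gamma> t = G (\<gamma> t) \<bullet> vector_derivative \<gamma> (at t within {0..a})"

definition line_integral ::
    "(real^3 \<Rightarrow> real^3) \<Rightarrow> real \<Rightarrow> (real \<Rightarrow> real^3) \<Rightarrow> real" where
  "line_integral G a \<gamma> = integral {0..a} (line_integrand G a \<gamma>)"

definition gradient_field_on :: "(real^3) set \<Rightarrow> (real^3 \<Rightarrow> real^3) \<Rightarrow> bool" where
  "gradient_field_on U G \<longleftrightarrow> (\<exists>\<phi> :: real^3 \<Rightarrow> real. \<forall>w\<in>U. GDERIV \<phi> w :> G w)"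

text \<open>Conservativity is asserted on simply connected open parts of the domain. A single-valued
  potential on the whole domain need not exist: for \<open>\<complex> \<times> \<real>\<close> and \<open>F (z, t) = (z, 1)\<close> the fields
  live on \<open>z \<noteq> 0\<close>, and one of them is the angular form \<open>d \<theta>\<close>.\<close>
definition conservative_on :: "(real^3) set \<Rightarrow> (real^3 \<Rightarrow> real^3) \<Rightarrow> bool" where
  "conservative_on S G \<longleftrightarrow>
     (\<forall>U. U \<subseteq> S \<and> open U \<and> simply_connected U \<longrightarrow> gradient_field_on U G)"

end

theory Submission
  imports Defs
begin

text \<open>
  Write \<open>H = e/F\<close>.  Expanding the product in coordinates, \<open>G k w\<close> is the vector that represents the
  linear functional \<open>v \<mapsto> (H w v)\<^sub>k\<close>.  This gives the formula for the integral coordinate by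
  coordinate, and it gives the duality relations, because \<open>H w (e\<^sub>i F w) = e\<^sub>i\<close>.  What remains
  is that the fields \<open>G k\<close> are conservative and that the integrals exist.

  Inversion in the algebra is differentiable on the open set of regular elements
  (\<open>has_derivative_alg_inverse\<close>), so \<open>H\<close> is differentiable on the regular domain, and its derivative
  at \<open>w\<close> is the multiplication by an element \<open>H' w\<close>.  The derivative of \<open>G k\<close> at \<open>w\<close> therefore
  corresponds to the bilinear form \<open>(u, v) \<mapsto> (H' w u v)\<^sub>k\<close>, which is symmetric because the algebra is
  commutative and associative: the form \<open>G k \<bullet> ds\<close> is closed.

  Closed forms are locally exact, but \<open>H'\<close> may be discontinuous, so one can neither differentiate
  under the integral sign nor apply Stokes' theorem.  As in complex analysis, Goursat's bisection
  of triangles replaces them: a field with symmetric derivative has vanishing integral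
  around every triangle and is thus a gradient on convex open sets
  (\<open>gradient_of_symmetric_derivative\<close>).

  Local potentials settle the integrability along a differentiable curve \<open>\<gamma>\<close>, even though \<open>\<gamma>'\<close>
  may be discontinuous: locally \<open>G k (\<gamma> t) \<bullet> \<gamma>' t\<close> is the derivative of a potential composed with
  \<open>\<gamma>\<close>, and the gauge integral integrates derivatives.  They also extend to a potential on each
  simply connected open set (\<open>gradient_on_simply_connected\<close>), since the integral over a
  sufficiently fine polygon inscribed in a path is invariant under homotopies that fix the end points.
\<close>

section \<open>Integrals along segments\<close>

text \<open>
  The velocity of \<open>\<gamma>\<close> need not be continuous: the gauge integral integrates every
  derivative, here that of \<open>\<phi> \<circ> \<gamma>\<close>.
\<close>

lemma has_integral_gradient_along_curve:
  fixes \<phi> :: "'a::real_inner \<Rightarrow> real" and \<gamma> :: "real \<Rightarrow> 'a"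
  assumes "u \<le> v"
    and \<gamma>: "\<And>t. t \<in> {u..v} \<Longrightarrow> (\<gamma> has_vector_derivative \<gamma>' t) (at t within {u..v})"
    and \<phi>: "\<And>t. t \<in> {u..v} \<Longrightarrow> GDERIV \<phi> (\<gamma> t) :> G (\<gamma> t)"
  shows "((\<lambda>t. G (\<gamma> t) \<bullet> \<gamma>' t) has_integral \<phi> (\<gamma> v) - \<phi> (\<gamma> u)) {u..v}"
proof -
  have "((\<phi> \<circ> \<gamma>) has_vector_derivative G (\<gamma> t) \<bullet> \<gamma>' t) (at t within {u..v})"
    if t: "t \<in> {u..v}" for t
  proof -
    have "(\<phi> has_derivative (\<lambda>h. h \<bullet> G (\<gamma> t))) (at (\<gamma> t) within \<gamma> ` {u..v})"
      using \<phi>[OF t] unfolding gderiv_def by (rule has_derivative_at_withinI)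
    from diff_chain_within[OF \<gamma>[OF t, unfolded has_vector_derivative_def] this]
    show ?thesis
      by (simp add: has_vector_derivative_def o_def inner_commute)
  qed
  from fundamental_theorem_of_calculus[OF \<open>u \<le> v\<close> this] show ?thesis
    by simp
qed

definition segment_integral :: "('a::real_inner \<Rightarrow> 'a) \<Rightarrow> 'a \<Rightarrow> 'a \<Rightarrow> real" where
  "segment_integral G a b = integral {0..1} (\<lambda>t. G (linepath a b t) \<bullet> (b - a))"

lemma segment_integral_refl [simp]: "segment_integral G a a = 0"
  by (simp add: segment_integral_def)

lemma linepath_in_closed_segment: "t \<in> {0..1} \<Longrightarrow> linepath a b t \<in> closed_segment a b"
  using linepath_image_01 by blast

lemma segment_integral_potential:
  fixes \<phi> :: "'a::real_inner \<Rightarrow> real"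
  assumes "\<And>z. z \<in> closed_segment a b \<Longrightarrow> GDERIV \<phi> z :> G z"
  shows "segment_integral G a b = \<phi> b - \<phi> a"
  using has_integral_gradient_along_curve[of 0 1 "linepath a b" "\<lambda>_. b - a" \<phi> G] assms
  by (auto simp: segment_integral_def has_vector_derivative_linepath_within linepath_in_closed_segment
      linepath_0' linepath_1' intro!: integral_unique)

text \<open>
  A segment integral over a piece of \<open>[a, b]\<close> is an increment of one function of the parameter.
  Reversal, bisection and subdivision into any number of pieces all follow from this.
\<close>

lemma segment_integral_additive:
  fixes G :: "'a::real_inner \<Rightarrow> 'a"
  assumes "continuous_on (closed_segment a b) G"
  obtains \<Psi> where "\<And>s t. \<lbrakk>s \<in> {0..1}; t \<in> {0..1}\<rbrakk> \<Longrightarrow>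
    segment_integral G (linepath a b s) (linepath a b t) = \<Psi> t - \<Psi> s"
proof -
  have "continuous_on {0..1} (\<lambda>u. G (linepath a b u) \<bullet> (b - a))"
    by (intro continuous_intros continuous_on_compose2[OF assms])
      (auto simp: linepath_image_01 linepath_in_closed_segment)
  then obtain \<Psi> where \<Psi>: "\<And>u. u \<in> {0..1} \<Longrightarrow>
      (\<Psi> has_vector_derivative G (linepath a b u) \<bullet> (b - a)) (at u within {0..1})"
    by (rule antiderivative_continuous) blast
  show thesis
  proof (rule that[of \<Psi>])
    fix s t :: real assume st: "s \<in> {0..1}" "t \<in> {0..1}"
    have sub: "linepath s t ` {0..1} \<subseteq> {0..1}"
      using st by (auto simp: linepath_image_01 closed_segment_eq_real_ivl)
    \<comment> \<open>The integrand on the piece is the full integrand pulled back along \<open>linepath s t\<close>; no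
       order between \<open>s\<close> and \<open>t\<close> is assumed, so that reversal is covered.\<close>
    have lin: "linepath (linepath a b s) (linepath a b t) r = linepath a b (linepath s t r)" for r
      by (simp add: linepath_def algebra_simps)
    have diff: "linepath a b t - linepath a b s = (t - s) *\<^sub>R (b - a)"
      by (simp add: linepath_def algebra_simps)
    have "((\<Psi> \<circ> linepath s t) has_vector_derivative
        (t - s) *\<^sub>R (G (linepath a b (linepath s t r)) \<bullet> (b - a))) (at r within {0..1})"
      if r: "r \<in> {0..1}" for r
      by (rule vector_diff_chain_within[OF has_vector_derivative_linepath_within
            has_vector_derivative_within_subset[OF \<Psi> sub]])
        (use sub r in blast)
    from fundamental_theorem_of_calculus[OF _ this]
    have "((\<lambda>r. (t - s) *\<^sub>R (G (linepath a b (linepath s t r)) \<bullet> (b - a))) has_integral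
        \<Psi> t - \<Psi> s) {0..1}"
      by (simp add: linepath_0' linepath_1')
    then show "segment_integral G (linepath a b s) (linepath a b t) = \<Psi> t - \<Psi> s"
      unfolding segment_integral_def lin diff by (intro integral_unique) simp
  qed
qed

lemma segment_integral_reverse:
  fixes G :: "'a::real_inner \<Rightarrow> 'a"
  assumes "continuous_on (closed_segment a b) G"
  shows "segment_integral G b a = - segment_integral G a b"
proof -
  obtain \<Psi> where \<Psi>: "\<And>s t. \<lbrakk>s \<in> {0..1}; t \<in> {0..1}\<rbrakk> \<Longrightarrow>
      segment_integral G (linepath a b s) (linepath a b t) = \<Psi> t - \<Psi> s"
    using segment_integral_additive[OF assms] by blast
  show ?thesis
    using \<Psi>[of 0 1] \<Psi>[of 1 0] by (simp add: linepath_0' linepath_1')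
qed

lemma segment_integral_midpoint:
  fixes G :: "'a::real_inner \<Rightarrow> 'a"
  assumes "continuous_on (closed_segment a b) G"
  shows "segment_integral G a b =
    segment_integral G a (midpoint a b) + segment_integral G (midpoint a b) b"
proof -
  obtain \<Psi> where \<Psi>: "\<And>s t. \<lbrakk>s \<in> {0..1}; t \<in> {0..1}\<rbrakk> \<Longrightarrow>
      segment_integral G (linepath a b s) (linepath a b t) = \<Psi> t - \<Psi> s"
    using segment_integral_additive[OF assms] by blast
  have "linepath a b (1/2) = midpoint a b"
    by (simp add: linepath_def midpoint_def scaleR_add_right)
  with \<Psi>[of 0 1] \<Psi>[of 0 "1/2"] \<Psi>[of "1/2" 1] show ?thesis
    by (simp add: linepath_0' linepath_1')
qed

lemma segment_integral_approx:
  fixes G L :: "'a::real_inner \<Rightarrow> 'a"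
  assumes "continuous_on (closed_segment a b) G" "continuous_on (closed_segment a b) L"
    and close: "\<And>z. z \<in> closed_segment a b \<Longrightarrow> norm (G z - L z) \<le> \<epsilon>"
  shows "\<bar>segment_integral G a b - segment_integral L a b\<bar> \<le> \<epsilon> * norm (b - a)"
proof -
  have cont: "continuous_on {0..1} (\<lambda>u. H (linepath a b u) \<bullet> (b - a))"
    if "continuous_on (closed_segment a b) H" for H
    by (intro continuous_intros continuous_on_compose2[OF that])
      (auto simp: linepath_image_01 linepath_in_closed_segment)
  have "segment_integral G a b - segment_integral L a b =
      integral {0..1} (\<lambda>t. G (linepath a b t) \<bullet> (b - a) - L (linepath a b t) \<bullet> (b - a))"
    unfolding segment_integral_def
    by (rule integral_diff[symmetric]; intro integrable_continuous_interval cont assms)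
  moreover have "norm (integral {0..1} (\<lambda>t. G (linepath a b t) \<bullet> (b - a) - L (linepath a b t) \<bullet> (b - a)))
      \<le> (\<epsilon> * norm (b - a)) * (1 - 0)"
  proof (rule integral_bound)
    fix t :: real assume "t \<in> {0..1}"
    then have "norm (G (linepath a b t) - L (linepath a b t)) \<le> \<epsilon>"
      by (intro close linepath_in_closed_segment)
    then show "norm (G (linepath a b t) \<bullet> (b - a) - L (linepath a b t) \<bullet> (b - a)) \<le> \<epsilon> * norm (b - a)"
      by (metis inner_diff_left Cauchy_Schwarz_ineq2 real_norm_def mult_right_mono norm_ge_zero order_trans)
  qed (use assms in \<open>auto intro!: continuous_on_diff cont\<close>)
  ultimately show ?thesis
    by simp
qed

section \<open>Fields with symmetric derivative on convex sets\<close>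

text \<open>
  A first-order Taylor polynomial of a field with symmetric derivative is a gradient, so that it
  contributes nothing to a triangle integral and only the Taylor remainder counts.
\<close>

lemma affine_symmetric_field_potential:
  fixes D :: "'a::real_inner \<Rightarrow> 'a"
  assumes D: "bounded_linear D" and sym: "\<And>u v. D u \<bullet> v = D v \<bullet> u"
  shows "GDERIV (\<lambda>y. v \<bullet> y + D (y - x) \<bullet> (y - x) / 2) z :> v + D (z - x)"
proof -
  have "((\<lambda>y. v \<bullet> y + D (y - x) \<bullet> (y - x) / 2) has_derivative
      (\<lambda>h. v \<bullet> h + (D (z - x) \<bullet> h + D h \<bullet> (z - x)) / 2)) (at z)"
    by (auto intro!: derivative_eq_intros bounded_linear.has_derivative[OF D])
  moreover have "(\<lambda>h. v \<bullet> h + (D (z - x) \<bullet> h + D h \<bullet> (z - x)) / 2) = (\<lambda>h. h \<bullet> (v + D (z - x)))"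
    using sym[of _ "z - x"] by (auto simp: inner_add_right inner_commute fun_eq_iff)
  ultimately show ?thesis
    by (simp add: gderiv_def)
qed

definition triangle_integral :: "('a::real_inner \<Rightarrow> 'a) \<Rightarrow> 'a \<Rightarrow> 'a \<Rightarrow> 'a \<Rightarrow> real" where
  "triangle_integral G a b c =
     segment_integral G a b + segment_integral G b c + segment_integral G c a"

lemma triangle_integral_bisect:
  fixes G :: "'a::real_inner \<Rightarrow> 'a"
  assumes cont: "continuous_on (convex hull {a, b, c}) G"
  shows "triangle_integral G a b c =
    triangle_integral G a (midpoint a b) (midpoint c a) +
    triangle_integral G (midpoint a b) b (midpoint b c) +
    triangle_integral G (midpoint c a) (midpoint b c) c +
    triangle_integral G (midpoint b c) (midpoint c a) (midpoint a b)"
proof -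
  have hull: "x \<in> convex hull {a, b, c}" if "x \<in> {a, b, c}" for x
    using that by (rule hull_inc)
  have mid: "midpoint x y \<in> convex hull {a, b, c}"
    if "x \<in> convex hull {a, b, c}" "y \<in> convex hull {a, b, c}" for x y
    using that convex_contains_segment[of "convex hull {a, b, c}"] midpoint_in_closed_segment by blast
  have c: "continuous_on (closed_segment x y) G"
    if "x \<in> convex hull {a, b, c}" "y \<in> convex hull {a, b, c}" for x y
    by (rule continuous_on_subset[OF cont]) (simp add: closed_segment_subset that)
  note rev = segment_integral_reverse[OF c]
  show ?thesis
    using segment_integral_midpoint[OF c, of a b] segment_integral_midpoint[OF c, of b c]
      segment_integral_midpoint[OF c, of c a]
      rev[of "midpoint a b" "midpoint c a"] rev[of "midpoint b c" "midpoint a b"]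
      rev[of "midpoint c a" "midpoint b c"]
    by (simp add: triangle_integral_def hull mid)
qed

text \<open>
  One of the four halved triangles carries at least a quarter of the integral.
\<close>

lemma triangle_integral_step:
  fixes G :: "'a::euclidean_space \<Rightarrow> 'a"
  assumes cont: "continuous_on (convex hull {a, b, c}) G"
    and big: "4 * K \<le> \<bar>triangle_integral G a b c\<bar>"
    and d: "dist a b \<le> 2 * d" "dist b c \<le> 2 * d" "dist c a \<le> 2 * d"
  shows "\<exists>a' b' c'. convex hull {a', b', c'} \<subseteq> convex hull {a, b, c} \<and>
    K \<le> \<bar>triangle_integral G a' b' c'\<bar> \<and>
    dist a' b' \<le> d \<and> dist b' c' \<le> d \<and> dist c' a' \<le> d"
proof -
  define p q r where "p = midpoint a b" and "q = midpoint b c" and "r = midpoint c a"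
  have side: "dist (midpoint x y) (midpoint y z) = dist x z / 2"
    "dist x (midpoint x y) = dist x y / 2" "dist (midpoint x y) x = dist x y / 2"
    "dist (midpoint x y) y = dist x y / 2" "dist y (midpoint x y) = dist x y / 2" for x y z :: 'a
  proof -
    have "midpoint x y - midpoint y z = (1/2) *\<^sub>R (x - z)"
      by (simp add: midpoint_def algebra_simps)
    then show "dist (midpoint x y) (midpoint y z) = dist x z / 2"
      by (simp add: dist_norm)
  qed (use dist_midpoint[of x y] in \<open>simp_all add: dist_commute\<close>)
  have cen: "dist p q \<le> d" "dist q r \<le> d" "dist r p \<le> d"
    using d side(1)[of a b c] side(1)[of b c a] side(1)[of c a b]
    by (simp_all add: p_def q_def r_def dist_commute)
  have edge: "dist a p \<le> d" "dist p b \<le> d" "dist b q \<le> d" "dist q c \<le> d" "dist c r \<le> d" "dist r a \<le> d"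
    using d by (simp_all add: p_def q_def r_def side)
  have hull: "a \<in> convex hull {a, b, c}" "b \<in> convex hull {a, b, c}" "c \<in> convex hull {a, b, c}"
    by (auto intro: hull_inc)
  have mid: "midpoint x y \<in> convex hull {a, b, c}"
    if "x \<in> convex hull {a, b, c}" "y \<in> convex hull {a, b, c}" for x y
    using that convex_contains_segment[of "convex hull {a, b, c}"] midpoint_in_closed_segment by blast
  have sub: "convex hull {x, y, z} \<subseteq> convex hull {a, b, c}"
    if "x \<in> {a, b, c, p, q, r}" "y \<in> {a, b, c, p, q, r}" "z \<in> {a, b, c, p, q, r}" for x y z
    by (rule hull_minimal) (use that hull mid in \<open>auto simp: p_def q_def r_def\<close>)
  have "triangle_integral G a b c = triangle_integral G a p r + triangle_integral G p b q +
      triangle_integral G r q c + triangle_integral G q r p"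
    using triangle_integral_bisect[OF cont] by (simp add: p_def q_def r_def)
  with big have "K \<le> \<bar>triangle_integral G a p r\<bar> \<or> K \<le> \<bar>triangle_integral G p b q\<bar> \<or>
      K \<le> \<bar>triangle_integral G r q c\<bar> \<or> K \<le> \<bar>triangle_integral G q r p\<bar>"
    by linarith
  then consider "K \<le> \<bar>triangle_integral G a p r\<bar>" | "K \<le> \<bar>triangle_integral G p b q\<bar>"
    | "K \<le> \<bar>triangle_integral G r q c\<bar>" | "K \<le> \<bar>triangle_integral G q r p\<bar>"
    by blast
  then show ?thesis
  proof cases
    case 1
    then show ?thesis using sub[of a p r] edge cen
      by (intro exI[of _ a] exI[of _ p] exI[of _ r]) (simp add: dist_commute)
  next
    case 2
    then show ?thesis using sub[of p b q] edge cen
      by (intro exI[of _ p] exI[of _ b] exI[of _ q]) (simp add: dist_commute)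
  next
    case 3
    then show ?thesis using sub[of r q c] edge cen
      by (intro exI[of _ r] exI[of _ q] exI[of _ c]) (simp add: dist_commute)
  next
    case 4
    then show ?thesis using sub[of q r p] edge cen
      by (intro exI[of _ q] exI[of _ r] exI[of _ p]) (simp add: dist_commute)
  qed
qed

text \<open>
  The affine approximation integrates to zero around the triangle, and on each side the remainder
  is at most \<open>\<epsilon>\<close> times the length of the side.  With \<open>\<epsilon>\<close> of order \<open>o(d)\<close> the bound is
  \<open>o(d\<^sup>2)\<close>, which is what repeated bisection can contradict.
\<close>

lemma triangle_integral_local_bound:
  fixes G :: "'a::euclidean_space \<Rightarrow> 'a"
  assumes cont: "continuous_on (convex hull {a, b, c}) G"
    and D: "(G has_derivative D) (at x)" and sym: "\<And>u v. D u \<bullet> v = D v \<bullet> u"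
    and approx: "\<And>y. y \<in> convex hull {a, b, c} \<Longrightarrow> norm (G y - (G x + D (y - x))) \<le> \<epsilon>"
    and d: "dist a b \<le> d" "dist b c \<le> d" "dist c a \<le> d" and "0 \<le> \<epsilon>"
  shows "\<bar>triangle_integral G a b c\<bar> \<le> 3 * \<epsilon> * d"
proof -
  define L where "L y = G x + D (y - x)" for y
  have bl: "bounded_linear D"
    using D by (rule has_derivative_bounded_linear)
  obtain \<psi> where \<psi>: "\<And>z. GDERIV \<psi> z :> L z"
    using that affine_symmetric_field_potential[OF bl sym] unfolding L_def by metis
  have L: "segment_integral L u v = \<psi> v - \<psi> u" for u v
    by (rule segment_integral_potential[OF \<psi>])
  have contL: "continuous_on S L" for S
    unfolding L_def by (intro continuous_intros bounded_linear.continuous_on[OF bl])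
  have seg: "\<bar>segment_integral G u v - segment_integral L u v\<bar> \<le> \<epsilon> * d"
    if "u \<in> {a, b, c}" "v \<in> {a, b, c}" "dist u v \<le> d" for u v
  proof -
    have s: "closed_segment u v \<subseteq> convex hull {a, b, c}"
      using that by (intro closed_segment_subset) (auto intro: hull_inc)
    have "\<bar>segment_integral G u v - segment_integral L u v\<bar> \<le> \<epsilon> * norm (v - u)"
      using s by (intro segment_integral_approx contL continuous_on_subset[OF cont])
        (auto simp: L_def intro: approx)
    also have "\<dots> \<le> \<epsilon> * d"
      using that \<open>0 \<le> \<epsilon>\<close> by (intro mult_left_mono) (auto simp: dist_norm norm_minus_commute)
    finally show ?thesis .
  qed
  show ?thesis
    using seg[of a b] seg[of b c] seg[of c a] d
    by (simp add: triangle_integral_def L)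
qed

text \<open>
  Goursat's argument.  It replaces Stokes' theorem, which would need the derivative to be
  continuous.  Repeated bisection yields triangles of diameter at most \<open>d / 2 ^ n\<close> on which the
  integral is at least \<open>K / 4 ^ n\<close> in absolute value; differentiability at their common point makes it
  \<open>o(1 / 4 ^ n)\<close>.
\<close>

theorem triangle_integral_symmetric_derivative:
  fixes G :: "'a::euclidean_space \<Rightarrow> 'a"
  assumes hull: "convex hull {a, b, c} \<subseteq> S"
    and deriv: "\<And>x. x \<in> S \<Longrightarrow> (G has_derivative D x) (at x)"
    and sym: "\<And>x u v. x \<in> S \<Longrightarrow> D x u \<bullet> v = D x v \<bullet> u"
  shows "triangle_integral G a b c = 0"
proof (rule ccontr)
  assume "triangle_integral G a b c \<noteq> 0"
  define K where "K = \<bar>triangle_integral G a b c\<bar>"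
  have "K > 0"
    using \<open>triangle_integral G a b c \<noteq> 0\<close> by (simp add: K_def)
  define d where "d = dist a b + dist b c + dist c a"
  have contS: "continuous_on S G"
    using deriv has_derivative_continuous by (intro continuous_at_imp_continuous_on) blast
  define P where "P n = (\<lambda>(a', b', c'). convex hull {a', b', c'} \<subseteq> convex hull {a, b, c} \<and>
      K / 4 ^ n \<le> \<bar>triangle_integral G a' b' c'\<bar> \<and>
      dist a' b' \<le> d / 2 ^ n \<and> dist b' c' \<le> d / 2 ^ n \<and> dist c' a' \<le> d / 2 ^ n)" for n
  define T where "T = (\<lambda>(a', b', c'). convex hull {a', b', c' :: 'a})"
  have "\<exists>t. \<forall>n. P n (t n) \<and> T (t (Suc n)) \<subseteq> T (t n)"
  proof (rule dependent_nat_choice)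
    show "\<exists>t. P 0 t"
      by (rule exI[of _ "(a, b, c)"]) (simp add: P_def K_def d_def)
  next
    fix t n assume "P n t"
    obtain a' b' c' where t: "t = (a', b', c')"
      by (cases t) auto
    have P: "convex hull {a', b', c'} \<subseteq> convex hull {a, b, c}"
      "4 * (K / 4 ^ Suc n) \<le> \<bar>triangle_integral G a' b' c'\<bar>"
      "dist a' b' \<le> 2 * (d / 2 ^ Suc n)" "dist b' c' \<le> 2 * (d / 2 ^ Suc n)"
      "dist c' a' \<le> 2 * (d / 2 ^ Suc n)"
      using \<open>P n t\<close> by (auto simp: P_def t)
    have "continuous_on (convex hull {a', b', c'}) G"
      using continuous_on_subset[OF contS] P(1) hull by blast
    from triangle_integral_step[OF this P(2-5)] P(1)
    obtain a'' b'' c'' where "convex hull {a'', b'', c''} \<subseteq> convex hull {a', b', c'}"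
      "P (Suc n) (a'', b'', c'')"
      unfolding P_def by auto
    then show "\<exists>t'. P (Suc n) t' \<and> T t' \<subseteq> T t"
      by (intro exI[of _ "(a'', b'', c'')"]) (simp add: T_def t)
  qed
  then obtain t where t: "\<And>n. P n (t n)" and nested: "\<And>n. T (t (Suc n)) \<subseteq> T (t n)"
    by blast
  have "\<Inter> (range (\<lambda>n. T (t n))) \<noteq> {}"
  proof (rule compact_nest)
    fix n show "compact (T (t n))"
      by (auto simp: T_def split: prod.split intro!: finite_imp_compact_convex_hull)
    show "T (t n) \<noteq> {}"
      by (auto simp: T_def split: prod.split)
    show "\<And>m. m \<le> n \<Longrightarrow> T (t n) \<subseteq> T (t m)"
      using lift_Suc_antimono_le[of "\<lambda>n. T (t n)"] nested by blast
  qed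
  then obtain x where x: "\<And>n. x \<in> T (t n)"
    by blast
  have xS: "x \<in> S"
    using x[of 0] t[of 0] hull by (cases "t 0") (auto simp: T_def P_def)
  have "d \<ge> 0"
    by (simp add: d_def)
  \<comment> \<open>Chosen so that \<open>3 * \<epsilon> * d\<^sup>2 < K\<close>; the summand \<open>1\<close> keeps the denominator positive.\<close>
  define \<epsilon> where "\<epsilon> = K / (6 * (d\<^sup>2 + 1))"
  have "\<epsilon> > 0"
    using \<open>K > 0\<close> by (auto simp: \<epsilon>_def add_nonneg_pos intro!: divide_pos_pos)
  obtain \<delta> where "\<delta> > 0" and \<delta>: "\<And>y. norm (y - x) < \<delta> \<Longrightarrow>
      norm (G y - G x - D x (y - x)) \<le> \<epsilon> * norm (y - x)"
    using deriv[OF xS] \<open>\<epsilon> > 0\<close> unfolding has_derivative_at_alt by blast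
  obtain n where n: "d / 2 ^ n < \<delta>"
    using real_arch_pow[of 2 "d / \<delta>"] \<open>\<delta> > 0\<close> by (auto simp: field_simps)
  obtain a' b' c' where tn: "t n = (a', b', c')"
    by (cases "t n") auto
  have P: "convex hull {a', b', c'} \<subseteq> S" "K / 4 ^ n \<le> \<bar>triangle_integral G a' b' c'\<bar>"
    "dist a' b' \<le> d / 2 ^ n" "dist b' c' \<le> d / 2 ^ n" "dist c' a' \<le> d / 2 ^ n"
    using t[of n] hull by (auto simp: P_def tn)
  have hull_cball: "convex hull {a', b', c'} \<subseteq> cball u (d / 2 ^ n)" if "u \<in> {a', b', c'}" for u
    using that P(3-5) \<open>d \<ge> 0\<close> by (intro hull_minimal) (auto simp: dist_commute)
  have "convex hull {a', b', c'} \<subseteq> cball x (d / 2 ^ n)"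
    using hull_cball[of a'] hull_cball[of b'] hull_cball[of c'] x[of n]
    by (intro hull_minimal) (auto simp: T_def tn dist_commute subset_iff)
  then have near: "norm (y - x) \<le> d / 2 ^ n" if "y \<in> convex hull {a', b', c'}" for y
    using that by (auto simp: dist_norm norm_minus_commute)
  have "\<bar>triangle_integral G a' b' c'\<bar> \<le> 3 * (\<epsilon> * (d / 2 ^ n)) * (d / 2 ^ n)"
  proof (rule triangle_integral_local_bound[OF _ deriv[OF xS] sym[OF xS] _ P(3-5)])
    show "continuous_on (convex hull {a', b', c'}) G"
      using continuous_on_subset[OF contS P(1)] .
    show "norm (G y - (G x + D x (y - x))) \<le> \<epsilon> * (d / 2 ^ n)" if "y \<in> convex hull {a', b', c'}" for y
    proof -
      have "norm (G y - G x - D x (y - x)) \<le> \<epsilon> * norm (y - x)"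
        using near[OF that] n by (intro \<delta>) auto
      also have "\<dots> \<le> \<epsilon> * (d / 2 ^ n)"
        using near[OF that] \<open>\<epsilon> > 0\<close> by (intro mult_left_mono) auto
      finally show ?thesis
        by (simp add: diff_diff_eq)
    qed
  qed (use \<open>\<epsilon> > 0\<close> \<open>d \<ge> 0\<close> in auto)
  also have "\<dots> = 3 * \<epsilon> * d\<^sup>2 / 4 ^ n"
    by (simp add: power2_eq_square flip: power_mult_distrib)
  finally have "K / 4 ^ n \<le> 3 * \<epsilon> * d\<^sup>2 / 4 ^ n"
    using P(2) by linarith
  then have "K \<le> 3 * \<epsilon> * d\<^sup>2"
    by (simp add: divide_le_cancel)
  also have "\<dots> \<le> 3 * \<epsilon> * (d\<^sup>2 + 1)"
    using \<open>\<epsilon> > 0\<close> by (intro mult_left_mono) auto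
  also have "\<dots> = K / 2"
  proof -
    have "d\<^sup>2 + 1 \<noteq> 0"
      by (smt (verit) zero_le_power2)
    then show ?thesis
      by (simp add: \<epsilon>_def field_simps)
  qed
  finally show False
    using \<open>K > 0\<close> by simp
qed

text \<open>
  The Poincare lemma for fields that are differentiable at every point of the set.  The potential
  at \<open>x\<close> is the integral along the segment from a base point \<open>p\<close>; since the triangle \<open>p\<close>, \<open>x\<close>,
  \<open>y\<close> contributes nothing, its increment from \<open>x\<close> to \<open>y\<close> is the integral along the segment from
  \<open>x\<close> to \<open>y\<close>, which is \<open>(y - x) \<bullet> G x\<close> up to \<open>o(norm (y - x))\<close>.
\<close>

theorem gradient_of_symmetric_derivative:
  fixes G :: "'a::euclidean_space \<Rightarrow> 'a"
  assumes "open S" "convex S"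
    and deriv: "\<And>x. x \<in> S \<Longrightarrow> (G has_derivative D x) (at x)"
    and sym: "\<And>x u v. x \<in> S \<Longrightarrow> D x u \<bullet> v = D x v \<bullet> u"
  shows "\<exists>\<phi>. \<forall>x\<in>S. GDERIV \<phi> x :> G x"
proof (cases "S = {}")
  case False
  then obtain p where p: "p \<in> S"
    by blast
  have contS: "continuous_on S G"
    using deriv has_derivative_continuous by (intro continuous_at_imp_continuous_on) blast
  have seg: "closed_segment x y \<subseteq> S" if "x \<in> S" "y \<in> S" for x y
    using that \<open>convex S\<close> by (simp add: closed_segment_subset)
  define \<phi> where "\<phi> x = segment_integral G p x" for x
  have incr: "\<phi> y - \<phi> x = segment_integral G x y" if xy: "x \<in> S" "y \<in> S" for x y
  proof -
    have "convex hull {p, x, y} \<subseteq> S"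
      using p xy \<open>convex S\<close> by (simp add: subset_hull)
    then have "triangle_integral G p x y = 0"
      using triangle_integral_symmetric_derivative deriv sym by blast
    moreover have "segment_integral G y p = - segment_integral G p y"
      using p xy by (intro segment_integral_reverse continuous_on_subset[OF contS] seg)
    ultimately show ?thesis
      by (simp add: triangle_integral_def \<phi>_def)
  qed
  have "GDERIV \<phi> x :> G x" if x: "x \<in> S" for x
    unfolding gderiv_def has_derivative_at_alt
  proof (intro conjI allI impI)
    show "bounded_linear (\<lambda>h. h \<bullet> G x)"
      by (rule bounded_linear_inner_left)
    fix \<epsilon> :: real assume "\<epsilon> > 0"
    obtain r where "r > 0" and r: "ball x r \<subseteq> S"
      using \<open>open S\<close> x open_contains_ball by blast
    have "isCont G x"
      using deriv[OF x] has_derivative_continuous by blast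
    then obtain \<delta> where "\<delta> > 0" and \<delta>: "\<And>y. dist y x < \<delta> \<Longrightarrow> dist (G y) (G x) < \<epsilon>"
      using \<open>\<epsilon> > 0\<close> unfolding continuous_at_eps_delta by blast
    show "\<exists>d>0. \<forall>y. norm (y - x) < d \<longrightarrow> norm (\<phi> y - \<phi> x - (y - x) \<bullet> G x) \<le> \<epsilon> * norm (y - x)"
    proof (intro exI[of _ "min \<delta> r"] conjI allI impI)
      fix y assume y: "norm (y - x) < min \<delta> r"
      have "y \<in> S"
        using y r by (auto simp: subset_iff dist_norm norm_minus_commute)
      have "segment_integral (\<lambda>_. G x) x y = G x \<bullet> y - G x \<bullet> x"
        by (rule segment_integral_potential)
          (auto simp: gderiv_def inner_commute intro!: derivative_eq_intros)
      then have const: "segment_integral (\<lambda>_. G x) x y = (y - x) \<bullet> G x"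
        by (simp add: inner_diff_right inner_commute)
      have "\<bar>segment_integral G x y - segment_integral (\<lambda>_. G x) x y\<bar> \<le> \<epsilon> * norm (y - x)"
      proof (rule segment_integral_approx)
        fix z assume "z \<in> closed_segment x y"
        then have "norm (z - x) \<le> norm (y - x)"
          by (metis dist_commute dist_in_closed_segment dist_norm)
        then show "norm (G z - G x) \<le> \<epsilon>"
          using \<delta>[of z] y by (simp add: dist_norm)
      qed (use x \<open>y \<in> S\<close> in \<open>auto intro: continuous_on_subset[OF contS seg]\<close>)
      then show "norm (\<phi> y - \<phi> x - (y - x) \<bullet> G x) \<le> \<epsilon> * norm (y - x)"
        by (simp add: incr[OF x \<open>y \<in> S\<close>] const)
    qed (use \<open>\<delta> > 0\<close> \<open>r > 0\<close> in auto)
  qed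
  then show ?thesis
    by blast
qed auto

section \<open>Local gradients on simply connected sets\<close>

definition locally_gradient_on :: "'a::real_inner set \<Rightarrow> ('a \<Rightarrow> 'a) \<Rightarrow> bool" where
  "locally_gradient_on U G \<longleftrightarrow> (\<forall>x\<in>U. \<exists>r>0. \<exists>\<phi>. \<forall>y\<in>ball x r. GDERIV \<phi> y :> G y)"

text \<open>
  A Lebesgue number: one radius serves for all points of a compact set.
\<close>

lemma locally_gradient_on_compact:
  fixes G :: "'a::real_inner \<Rightarrow> 'a"
  assumes loc: "locally_gradient_on U G" and "compact K" "K \<subseteq> U"
  obtains \<delta> where "\<delta> > 0" "\<And>x. x \<in> K \<Longrightarrow> \<exists>\<phi>. \<forall>y\<in>ball x \<delta>. GDERIV \<phi> y :> G y"
proof -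
  define \<G> where "\<G> = {V. open V \<and> (\<exists>\<phi>. \<forall>y\<in>V. GDERIV \<phi> y :> G y)}"
  have cover: "K \<subseteq> \<Union> \<G>"
  proof
    fix x assume "x \<in> K"
    then obtain r \<phi> where "r > 0" "\<forall>y\<in>ball x r. GDERIV \<phi> y :> G y"
      using loc \<open>K \<subseteq> U\<close> unfolding locally_gradient_on_def by blast
    then show "x \<in> \<Union> \<G>"
      by (intro UnionI[of "ball x r"]) (auto simp: \<G>_def)
  qed
  have opn: "\<And>V. V \<in> \<G> \<Longrightarrow> open V"
    by (simp add: \<G>_def)
  obtain \<delta> where "\<delta> > 0" and \<delta>: "\<And>x. x \<in> K \<Longrightarrow> \<exists>V\<in>\<G>. ball x \<delta> \<subseteq> V"
    using Heine_Borel_lemma[OF \<open>compact K\<close> cover opn] by blast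
  have "\<exists>\<phi>. \<forall>y\<in>ball x \<delta>. GDERIV \<phi> y :> G y" if x: "x \<in> K" for x
  proof -
    obtain V where "V \<in> \<G>" and V: "ball x \<delta> \<subseteq> V"
      using \<delta>[OF x] by blast
    then obtain \<phi> where "\<forall>y\<in>V. GDERIV \<phi> y :> G y"
      unfolding \<G>_def by blast
    then have "\<forall>y\<in>ball x \<delta>. GDERIV \<phi> y :> G y"
      using V by blast
    then show ?thesis
      by (rule exI[of _ \<phi>])
  qed
  then show thesis
    using that \<open>\<delta> > 0\<close> by blast
qed

lemma segment_integral_ball:
  fixes G :: "'a::real_inner \<Rightarrow> 'a"
  assumes "\<forall>y\<in>ball x r. GDERIV \<phi> y :> G y" "a \<in> ball x r" "b \<in> ball x r"
  shows "segment_integral G a b = \<phi> b - \<phi> a"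
proof (rule segment_integral_potential)
  fix z assume "z \<in> closed_segment a b"
  then have "z \<in> ball x r"
    using closed_segment_subset[OF assms(2,3) convex_ball] by blast
  then show "GDERIV \<phi> z :> G z"
    using assms(1) by blast
qed

text \<open>
  The integral of \<open>G\<close> along the polygon with vertices \<open>\<gamma> (i / N)\<close>.  Where \<open>G\<close> is locally a gradient
  and \<open>N\<close> is large, this serves as the integral of \<open>G\<close> along \<open>\<gamma>\<close> when \<open>\<gamma>\<close> is merely continuous.
\<close>

definition chain_sum :: "('a::real_inner \<Rightarrow> 'a) \<Rightarrow> (real \<Rightarrow> 'a) \<Rightarrow> nat \<Rightarrow> real" where
  "chain_sum G \<gamma> N =
     (\<Sum>i<N. segment_integral G (\<gamma> (real i / real N)) (\<gamma> (real (Suc i) / real N)))"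

text \<open>
  Divide the parameter square of the homotopy \<open>h\<close> into \<open>N\<^sup>2\<close> cells, so fine that \<open>h\<close> maps each of
  them into a ball on which \<open>G\<close> has a potential.  Then the sums along two adjacent rows of grid
  points differ only by the contributions of the two vertical edges, and these vanish because the
  homotopy keeps the end points fixed.
\<close>

lemma chain_sum_homotopic:
  fixes G :: "'a::real_inner \<Rightarrow> 'a"
  assumes loc: "locally_gradient_on U G" and hom: "homotopic_paths U p q"
  shows "\<forall>\<^sub>F N in sequentially. chain_sum G p N = chain_sum G q N"
proof -
  obtain h where conth: "continuous_on ({0..1::real} \<times> {0..1::real}) h"
    and him: "h \<in> ({0..1} \<times> {0..1}) \<rightarrow> U"
    and h0: "\<forall>x\<in>{0..1}. h (0, x) = p x" and h1: "\<forall>x\<in>{0..1}. h (1, x) = q x"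
    and ends: "\<forall>t\<in>{0..1}. h (t, 0) = p 0 \<and> h (t, 1) = p 1"
    using hom unfolding homotopic_paths pathstart_def pathfinish_def o_def by blast
  define Q where "Q = {0..1::real} \<times> {0..1::real}"
  have Q: "compact Q"
    by (simp add: Q_def compact_Times)
  have "compact (h ` Q)" "h ` Q \<subseteq> U"
    using conth him Q by (auto simp: Q_def intro: compact_continuous_image)
  then obtain \<delta> where "\<delta> > 0"
    and \<delta>: "\<And>x. x \<in> h ` Q \<Longrightarrow> \<exists>\<phi>. \<forall>y\<in>ball x \<delta>. GDERIV \<phi> y :> G y"
    using locally_gradient_on_compact[OF loc] by blast
  have "uniformly_continuous_on Q h"
    using conth Q unfolding Q_def by (rule compact_uniformly_continuous)
  then obtain \<eta> where "\<eta> > 0"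
    and \<eta>: "\<And>x x'. \<lbrakk>x \<in> Q; x' \<in> Q; dist x' x < \<eta>\<rbrakk> \<Longrightarrow> dist (h x') (h x) < \<delta>"
    unfolding uniformly_continuous_on_def using \<open>\<delta> > 0\<close> by meson
  obtain N0 :: nat where N0: "2 / \<eta> < real N0"
    using reals_Archimedean2 by blast
  have "chain_sum G p N = chain_sum G q N" if "N \<ge> max 1 N0" for N
  proof -
    have N: "0 < N" "2 / real N < \<eta>"
    proof -
      show "0 < N"
        using that by simp
      have "2 / \<eta> < real N"
        using that N0 by simp
      then show "2 / real N < \<eta>"
        using \<open>\<eta> > 0\<close> \<open>0 < N\<close> by (simp add: field_simps)
    qed
    define P where "P i j = h (real i / real N, real j / real N)" for i j
    define row where "row i = (\<Sum>j<N. segment_integral G (P i j) (P i (Suc j)))" for i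
    have grid: "(real i / real N, real j / real N) \<in> Q" if "i \<le> N" "j \<le> N" for i j
      using that N(1) by (simp add: Q_def)
    \<comment> \<open>Both ways around a cell lead from one corner to the opposite one.\<close>
    have cell: "segment_integral G (P i j) (P i (Suc j)) + segment_integral G (P i (Suc j)) (P (Suc i) (Suc j))
        = segment_integral G (P i j) (P (Suc i) j) + segment_integral G (P (Suc i) j) (P (Suc i) (Suc j))"
      if ij: "i < N" "j < N" for i j
    proof -
      obtain \<phi> where \<phi>: "\<forall>y\<in>ball (P i j) \<delta>. GDERIV \<phi> y :> G y"
        using \<delta>[of "P i j"] grid[of i j] ij unfolding P_def by auto
      have near: "P i' j' \<in> ball (P i j) \<delta>" if "i' \<in> {i, Suc i}" "j' \<in> {j, Suc j}" for i' j'
      proof -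
        have "dist (real i' / real N, real j' / real N) (real i / real N, real j / real N)
            \<le> dist (real i' / real N) (real i / real N) + dist (real j' / real N) (real j / real N)"
          by (simp add: dist_Pair_Pair sqrt_sum_squares_le_sum)
        also have "\<dots> \<le> 1 / real N + 1 / real N"
          using that by (intro add_mono) (auto simp: dist_real_def simp flip: diff_divide_distrib)
        also have "\<dots> < \<eta>"
          using N by simp
        finally have "dist (P i' j') (P i j) < \<delta>"
          unfolding P_def using ij that by (intro \<eta> grid) auto
        then show ?thesis
          by (simp add: dist_commute)
      qed
      show ?thesis
        by (simp add: segment_integral_ball[OF \<phi> near near])
    qed
    have "row (Suc i) = row i" if i: "i < N" for i
    proof -
      define B where "B j = segment_integral G (P i j) (P (Suc i) j)" for j
      have "segment_integral G (P (Suc i) j) (P (Suc i) (Suc j)) - segment_integral G (P i j) (P i (Suc j))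
          = B (Suc j) - B j" if "j < N" for j
        using cell[OF i that] by (simp add: B_def)
      then have "row (Suc i) - row i = (\<Sum>j<N. B (Suc j) - B j)"
        unfolding row_def sum_subtractf[symmetric] by (intro sum.cong) auto
      also have "\<dots> = B N - B 0"
        by (rule sum_lessThan_telescope)
      also have "\<dots> = 0"
      proof -
        have "P i' 0 = p 0" "P i' N = p 1" if "i' \<le> N" for i'
          using that N ends by (simp_all add: P_def)
        then show ?thesis
          using i by (simp add: B_def)
      qed
      finally show ?thesis
        by simp
    qed
    then have "i \<le> N \<Longrightarrow> row i = row 0" for i
      by (induction i) auto
    from this[of N] have "row N = row 0"
      by simp
    moreover have "row 0 = chain_sum G p N" "row N = chain_sum G q N"
      unfolding row_def chain_sum_def P_def using N h0 h1
      by (auto intro!: sum.cong simp del: of_nat_Suc)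
    ultimately show ?thesis
      by simp
  qed
  then show ?thesis
    unfolding eventually_sequentially by blast
qed

text \<open>
  The two halves of a step and the step itself lie in one ball on which \<open>G\<close> has a potential.
\<close>

lemma chain_sum_refine:
  fixes G :: "'a::real_inner \<Rightarrow> 'a"
  assumes loc: "locally_gradient_on U G" and "path \<gamma>" "path_image \<gamma> \<subseteq> U"
  shows "\<forall>\<^sub>F N in sequentially. chain_sum G \<gamma> (2 * N) = chain_sum G \<gamma> N"
proof -
  obtain \<delta> where "\<delta> > 0"
    and \<delta>: "\<And>x. x \<in> path_image \<gamma> \<Longrightarrow> \<exists>\<phi>. \<forall>y\<in>ball x \<delta>. GDERIV \<phi> y :> G y"
    using locally_gradient_on_compact[OF loc compact_path_image] assms by blast
  have "uniformly_continuous_on {0..1} \<gamma>"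
    using \<open>path \<gamma>\<close> unfolding path_def by (rule compact_uniformly_continuous) simp
  then obtain \<eta> where "\<eta> > 0"
    and \<eta>: "\<And>x x'. \<lbrakk>x \<in> {0..1}; x' \<in> {0..1}; dist x' x < \<eta>\<rbrakk> \<Longrightarrow> dist (\<gamma> x') (\<gamma> x) < \<delta>"
    unfolding uniformly_continuous_on_def using \<open>\<delta> > 0\<close> by meson
  obtain N0 :: nat where N0: "1 / \<eta> < real N0"
    using reals_Archimedean2 by blast
  have "chain_sum G \<gamma> (2 * N) = chain_sum G \<gamma> N" if "N \<ge> max 1 N0" for N
  proof -
    have N: "0 < N" "1 / real N < \<eta>"
    proof -
      show "0 < N"
        using that by simp
      have "1 / \<eta> < real N"
        using that N0 by simp
      then show "1 / real N < \<eta>"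
        using \<open>\<eta> > 0\<close> \<open>0 < N\<close> by (simp add: field_simps)
    qed
    define P where "P i = \<gamma> (real i / real (2 * N))" for i
    have split: "segment_integral G (P (2 * i)) (P (2 * i + 1)) + segment_integral G (P (2 * i + 1)) (P (2 * i + 2))
        = segment_integral G (P (2 * i)) (P (2 * i + 2))" if i: "i < N" for i
    proof -
      have "P (2 * i) \<in> path_image \<gamma>"
        using i by (auto simp: P_def path_image_def)
      then obtain \<phi> where \<phi>: "\<forall>y\<in>ball (P (2 * i)) \<delta>. GDERIV \<phi> y :> G y"
        using \<delta> by blast
      have near: "P (2 * i + k) \<in> ball (P (2 * i)) \<delta>" if "k \<le> 2" for k
      proof -
        have "dist (real (2 * i + k) / real (2 * N)) (real (2 * i) / real (2 * N)) = real k / real (2 * N)"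
          by (simp add: dist_real_def add_divide_distrib)
        also have "\<dots> \<le> 1 / real N"
          using that N by (simp add: field_simps)
        also have "\<dots> < \<eta>"
          by (rule N)
        finally have "dist (P (2 * i + k)) (P (2 * i)) < \<delta>"
          unfolding P_def using i that N by (intro \<eta>) auto
        then show ?thesis
          by (simp add: dist_commute)
      qed
      show ?thesis
        using segment_integral_ball[OF \<phi>] near[of 0] near[of 1] near[of 2] by simp
    qed
    have sum2: "(\<Sum>i<2 * n. f i) = (\<Sum>i<n. f (2 * i) + f (2 * i + 1))" for f :: "nat \<Rightarrow> real" and n
      by (induction n) (auto simp: algebra_simps)
    have "chain_sum G \<gamma> (2 * N) = (\<Sum>i<2 * N. segment_integral G (P i) (P (i + 1)))"
      by (simp add: chain_sum_def P_def)
    also have "\<dots> = (\<Sum>i<N. segment_integral G (P (2 * i)) (P (2 * i + 2)))"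
      unfolding sum2 using split by (intro sum.cong) (auto simp: add.assoc)
    also have "\<dots> = chain_sum G \<gamma> N"
    proof -
      have "P (2 * i) = \<gamma> (real i / real N)" "P (2 * i + 2) = \<gamma> (real (Suc i) / real N)" for i
      proof -
        show P2: "P (2 * i) = \<gamma> (real i / real N)" for i
          by (simp add: P_def)
        show "P (2 * i + 2) = \<gamma> (real (Suc i) / real N)"
          using P2[of "Suc i"] by simp
      qed
      then show ?thesis
        by (simp add: chain_sum_def)
    qed
    finally show ?thesis .
  qed
  then show ?thesis
    unfolding eventually_sequentially by blast
qed

lemma chain_sum_join:
  assumes "pathfinish \<gamma> = pathstart \<gamma>'"
  shows "chain_sum G (\<gamma> +++ \<gamma>') (2 * N) = chain_sum G \<gamma> N + chain_sum G \<gamma>' N"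
proof (cases "N = 0")
  case False
  define P where "P i = (\<gamma> +++ \<gamma>') (real i / real (2 * N))" for i
  have left: "P i = \<gamma> (real i / real N)" if "i \<le> N" for i
    using that False by (simp add: P_def joinpaths_def)
  have right: "P (N + i) = \<gamma>' (real i / real N)" for i
  proof (cases "i = 0")
    case True
    then show ?thesis
      using left[of N] False assms by (simp add: pathfinish_def pathstart_def)
  next
    case i: False
    then have "\<not> real (N + i) / real (2 * N) \<le> 1 / 2"
      using False by (simp add: field_simps)
    moreover have "2 * (real (N + i) / real (2 * N)) - 1 = real i / real N"
      using False by (simp add: field_simps)
    ultimately show ?thesis
      by (simp add: P_def joinpaths_def)
  qed
  have sum_add: "(\<Sum>i<n + m. f i) = (\<Sum>i<n. f i) + (\<Sum>i<m. f (n + i))" for f :: "nat \<Rightarrow> real" and n m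
    by (induction m) auto
  have "chain_sum G (\<gamma> +++ \<gamma>') (2 * N) = (\<Sum>i<N + N. segment_integral G (P i) (P (Suc i)))"
    by (simp only: chain_sum_def P_def mult_2)
  also have "\<dots> = (\<Sum>i<N. segment_integral G (P i) (P (Suc i))) +
      (\<Sum>i<N. segment_integral G (P (N + i)) (P (N + Suc i)))"
    using sum_add[of "\<lambda>i. segment_integral G (P i) (P (Suc i))" N N] by simp
  also have "\<dots> = chain_sum G \<gamma> N + chain_sum G \<gamma>' N"
    unfolding right by (simp add: left chain_sum_def)
  finally show ?thesis .
qed (simp add: chain_sum_def)

lemma chain_sum_linepath:
  fixes G :: "'a::real_inner \<Rightarrow> 'a"
  assumes "continuous_on (closed_segment a b) G" "N > 0"
  shows "chain_sum G (linepath a b) N = segment_integral G a b"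
proof -
  obtain \<Psi> where \<Psi>: "\<And>s t. \<lbrakk>s \<in> {0..1}; t \<in> {0..1}\<rbrakk> \<Longrightarrow>
      segment_integral G (linepath a b s) (linepath a b t) = \<Psi> t - \<Psi> s"
    using segment_integral_additive[OF assms(1)] by blast
  have "chain_sum G (linepath a b) N = (\<Sum>i<N. \<Psi> (real (Suc i) / real N) - \<Psi> (real i / real N))"
    unfolding chain_sum_def by (intro sum.cong \<Psi>) auto
  also have "\<dots> = \<Psi> 1 - \<Psi> 0"
    using sum_lessThan_telescope[of "\<lambda>i. \<Psi> (real i / real N)" N] assms(2) by simp
  also have "\<dots> = segment_integral G a b"
    using \<Psi>[of 0 1] by (simp add: linepath_0' linepath_1')
  finally show ?thesis .
qed

text \<open>
  Halving all steps of a fine subdivision preserves the sum, and powers of two are linked by halving.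
\<close>

lemma chain_sum_eventually_const:
  fixes G :: "'a::real_inner \<Rightarrow> 'a"
  assumes "locally_gradient_on U G" "path \<gamma>" "path_image \<gamma> \<subseteq> U"
  shows "\<exists>l. \<forall>\<^sub>F n in sequentially. chain_sum G \<gamma> (2 ^ n) = l"
proof -
  obtain N where N: "\<And>n. n \<ge> N \<Longrightarrow> chain_sum G \<gamma> (2 * n) = chain_sum G \<gamma> n"
    using chain_sum_refine[OF assms] unfolding eventually_sequentially by blast
  have "chain_sum G \<gamma> (2 ^ (N + k)) = chain_sum G \<gamma> (2 ^ N)" for k
  proof (induction k)
    case (Suc k)
    have "N \<le> 2 ^ (N + k)"
      by (meson le_add1 le_trans less_exp less_imp_le)
    then show ?case
      using N[of "2 ^ (N + k)"] Suc by simp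
  qed simp
  then show ?thesis
    unfolding eventually_sequentially by (metis le_iff_add)
qed

text \<open>
  The potential at \<open>x\<close> is the common value of the fine chain sums along a chosen path from a base
  point to \<open>x\<close>.  Extending the path to \<open>x\<close> by a short segment to \<open>y\<close> gives a path homotopic to the
  one chosen for \<open>y\<close>; hence this function and a local potential have the same increments near \<open>x\<close>.
\<close>

theorem gradient_on_simply_connected:
  fixes G :: "'a::euclidean_space \<Rightarrow> 'a"
  assumes loc: "locally_gradient_on U G" and contG: "continuous_on U G"
    and "open U" "simply_connected U"
  shows "\<exists>\<Phi>. \<forall>x\<in>U. GDERIV \<Phi> x :> G x"
proof (cases "U = {}")
  case False
  then obtain p where p: "p \<in> U"
    by blast
  have pc: "path_connected U"
    and hom: "\<And>\<gamma> \<gamma>'. \<lbrakk>path \<gamma>; path_image \<gamma> \<subseteq> U; path \<gamma>'; path_image \<gamma>' \<subseteq> U;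
      pathstart \<gamma>' = pathstart \<gamma>; pathfinish \<gamma>' = pathfinish \<gamma>\<rbrakk> \<Longrightarrow> homotopic_paths U \<gamma> \<gamma>'"
    using \<open>simply_connected U\<close> unfolding simply_connected_eq_homotopic_paths by blast+
  have "\<forall>x\<in>U. \<exists>\<gamma>. path \<gamma> \<and> path_image \<gamma> \<subseteq> U \<and> pathstart \<gamma> = p \<and> pathfinish \<gamma> = x"
    using pc p unfolding path_connected_def by blast
  then obtain \<gamma> where \<gamma>: "\<And>x. x \<in> U \<Longrightarrow> path (\<gamma> x) \<and> path_image (\<gamma> x) \<subseteq> U \<and>
      pathstart (\<gamma> x) = p \<and> pathfinish (\<gamma> x) = x"
    by metis
  have "\<forall>x\<in>U. \<exists>l. \<forall>\<^sub>F n in sequentially. chain_sum G (\<gamma> x) (2 ^ n) = l"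
    using chain_sum_eventually_const[OF loc] \<gamma> by blast
  then obtain \<Phi> where \<Phi>: "\<And>x. x \<in> U \<Longrightarrow> \<forall>\<^sub>F n in sequentially. chain_sum G (\<gamma> x) (2 ^ n) = \<Phi> x"
    by metis
  have incr: "\<Phi> y = \<Phi> x + segment_integral G x y" if xy: "closed_segment x y \<subseteq> U" for x y
  proof -
    have "x \<in> U" "y \<in> U"
      using xy by auto
    define \<sigma> where "\<sigma> = \<gamma> x +++ linepath x y"
    have join: "chain_sum G \<sigma> (2 ^ Suc n) = chain_sum G (\<gamma> x) (2 ^ n) + segment_integral G x y" for n
    proof -
      have "pathfinish (\<gamma> x) = pathstart (linepath x y)"
        using \<gamma>[OF \<open>x \<in> U\<close>] by simp
      from chain_sum_join[OF this] show ?thesis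
        by (simp add: \<sigma>_def chain_sum_linepath continuous_on_subset[OF contG xy])
    qed
    have "homotopic_paths U \<sigma> (\<gamma> y)"
      unfolding \<sigma>_def using \<gamma>[OF \<open>x \<in> U\<close>] \<gamma>[OF \<open>y \<in> U\<close>] xy
      by (intro hom) (auto simp: path_image_join)
    then have "\<forall>\<^sub>F N in sequentially. chain_sum G \<sigma> N = chain_sum G (\<gamma> y) N"
      by (rule chain_sum_homotopic[OF loc])
    moreover have "filterlim (\<lambda>n. 2 ^ Suc n :: nat) sequentially sequentially"
      by (rule filterlim_subseq) (auto simp: strict_mono_def)
    ultimately have "\<forall>\<^sub>F n in sequentially. chain_sum G \<sigma> (2 ^ Suc n) = chain_sum G (\<gamma> y) (2 ^ Suc n)"
      by (rule eventually_compose_filterlim)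
    moreover have "\<forall>\<^sub>F n in sequentially. chain_sum G (\<gamma> y) (2 ^ Suc n) = \<Phi> y"
      using \<Phi>[OF \<open>y \<in> U\<close>] by (simp only: eventually_sequentially_Suc[of "\<lambda>n. chain_sum G (\<gamma> y) (2 ^ n) = \<Phi> y"])
    ultimately have "\<forall>\<^sub>F n in sequentially. \<Phi> y = \<Phi> x + segment_integral G x y"
      using \<Phi>[OF \<open>x \<in> U\<close>] by eventually_elim (use join in simp)
    then show ?thesis
      by simp
  qed
  have "GDERIV \<Phi> x :> G x" if x: "x \<in> U" for x
  proof -
    obtain r \<phi> where "r > 0" and \<phi>: "\<forall>y\<in>ball x r. GDERIV \<phi> y :> G y"
      using loc x unfolding locally_gradient_on_def by blast
    obtain r' where "r' > 0" and r': "ball x r' \<subseteq> U"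
      using \<open>open U\<close> x open_contains_ball by blast
    define V where "V = ball x (min r r')"
    have "x \<in> V"
      using \<open>r > 0\<close> \<open>r' > 0\<close> by (simp add: V_def)
    have "GDERIV \<phi> x :> G x"
      using \<phi> \<open>r > 0\<close> by simp
    then have "((\<lambda>y. \<phi> y + (\<Phi> x - \<phi> x)) has_derivative (\<lambda>h. h \<bullet> G x)) (at x)"
      unfolding gderiv_def by (auto intro!: derivative_eq_intros)
    moreover have "\<phi> y + (\<Phi> x - \<phi> x) = \<Phi> y" if y: "y \<in> V" for y
    proof -
      have "segment_integral G x y = \<phi> y - \<phi> x"
        using y \<open>r > 0\<close> by (intro segment_integral_ball[OF \<phi>]) (auto simp: V_def)
      moreover have "closed_segment x y \<subseteq> V"
        using \<open>x \<in> V\<close> y by (simp add: V_def closed_segment_subset)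
      then have "closed_segment x y \<subseteq> U"
        using r' unfolding V_def by (meson ball_subset_ball_iff min.cobounded2 subset_ball subset_trans)
      ultimately show ?thesis
        using incr by simp
    qed
    moreover have "open V"
      by (simp add: V_def)
    ultimately show ?thesis
      unfolding gderiv_def using \<open>x \<in> V\<close> has_derivative_transform_within_open[of _ _ x UNIV V \<Phi>] by blast
  qed
  then show ?thesis
    by blast
qed auto

section \<open>Integrability along differentiable curves\<close>

text \<open>
  Integrability is a local property, and locally the integrand is the derivative of \<open>\<phi> \<circ> \<gamma>\<close> for a
  local potential \<open>\<phi>\<close>.
\<close>

lemma line_integrand_integrable:
  assumes loc: "locally_gradient_on U G"
    and diff: "\<gamma> differentiable_on {0..a}" and im: "\<gamma> ` {0..a} \<subseteq> U"
  shows "line_integrand G a \<gamma> integrable_on {0..a}"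
proof -
  have "line_integrand G a \<gamma> integrable_on cbox 0 a"
  proof (rule integrable_on_little_subintervals, unfold box_real, intro ballI)
    fix x assume x: "x \<in> {0..a}"
    then obtain r \<phi> where "r > 0" and \<phi>: "\<forall>y\<in>ball (\<gamma> x) r. GDERIV \<phi> y :> G y"
      using loc im unfolding locally_gradient_on_def by blast
    have "continuous_on {0..a} \<gamma>"
      using diff by (rule differentiable_imp_continuous_on)
    then obtain d where "d > 0" and d: "\<And>t. \<lbrakk>t \<in> {0..a}; dist t x < d\<rbrakk> \<Longrightarrow> dist (\<gamma> t) (\<gamma> x) < r"
      using x \<open>r > 0\<close> unfolding continuous_on_iff by metis
    have "line_integrand G a \<gamma> integrable_on {u..v}"
      if uv: "x \<in> {u..v}" "{u..v} \<subseteq> ball x d" "{u..v} \<subseteq> {0..a}" for u v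
    proof -
      have "((\<lambda>t. G (\<gamma> t) \<bullet> vector_derivative \<gamma> (at t within {0..a})) has_integral
          \<phi> (\<gamma> v) - \<phi> (\<gamma> u)) {u..v}"
      proof (rule has_integral_gradient_along_curve)
        show "u \<le> v"
          using uv(1) by simp
        fix t assume t: "t \<in> {u..v}"
        then have t': "t \<in> {0..a}"
          using uv(3) by blast
        then have "(\<gamma> has_vector_derivative vector_derivative \<gamma> (at t within {0..a})) (at t within {0..a})"
          using diff unfolding differentiable_on_def by (simp add: vector_derivative_works)
        then show "(\<gamma> has_vector_derivative vector_derivative \<gamma> (at t within {0..a})) (at t within {u..v})"
          using uv(3) by (rule has_vector_derivative_within_subset)
        have "t \<in> ball x d"
          using t uv(2) by blast
        then have "\<gamma> t \<in> ball (\<gamma> x) r"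
          using d[OF t'] by (simp add: dist_commute)
        then show "GDERIV \<phi> (\<gamma> t) :> G (\<gamma> t)"
          using \<phi> by blast
      qed
      then show ?thesis
        unfolding line_integrand_def by (rule has_integral_integrable)
    qed
    then show "\<exists>d>0. \<forall>u v. x \<in> {u..v} \<and> {u..v} \<subseteq> ball x d \<and> {u..v} \<subseteq> {0..a} \<longrightarrow>
        line_integrand G a \<gamma> integrable_on {u..v}"
      using \<open>d > 0\<close> by blast
  qed
  then show ?thesis
    by simp
qed

section \<open>Inverses and reciprocals in the algebra\<close>

locale r3_algebra_product =
  fixes mul :: "real^3 \<Rightarrow> real^3 \<Rightarrow> real^3" and e :: "real^3"
  assumes alg: "r3_algebra mul e"
begin

lemma bilin: "bilinear mul"
  and assoc: "mul (mul x y) z = mul x (mul y z)"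
  and comm: "mul x y = mul y x"
  and unit: "mul e x = x"
  using alg unfolding r3_algebra_def by blast+

sublocale mul: bounded_bilinear mul
  using bilin by (simp add: bilinear_conv_bounded_bilinear)

lemma alg_inverse_eq:
  assumes "mul a b = e"
  shows "alg_inverse mul e a = b"
  unfolding alg_inverse_def
proof (rule the_equality)
  show "mul a b = e"
    by (rule assms)
  fix b' assume "mul a b' = e"
  then show "b' = b"
    using assms by (metis assoc comm unit)
qed

lemma mul_alg_inverse:
  assumes "a \<in> regular_elements mul e"
  shows "mul a (alg_inverse mul e a) = e"
proof -
  obtain b where b: "mul a b = e"
    using assms unfolding regular_elements_def by blast
  then show ?thesis
    by (simp add: alg_inverse_eq[OF b])
qed

text \<open>
  If \<open>b\<close> is the inverse of \<open>a\<close> and \<open>x\<close> is close to \<open>a\<close>, then \<open>x\<close> is not a zero divisor, because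
  \<open>x y = 0\<close> gives \<open>y = b (a - x) y\<close>, whose norm is less than that of \<open>y\<close> unless \<open>y = 0\<close>.  In finite
  dimension, injectivity of the multiplication by \<open>x\<close> makes it surjective.
\<close>

lemma open_regular_elements: "open (regular_elements mul e)"
  unfolding open_contains_ball
proof
  fix a assume "a \<in> regular_elements mul e"
  then obtain b where b: "mul a b = e"
    unfolding regular_elements_def by blast
  obtain K where "K > 0" and K: "\<And>x y. norm (mul x y) \<le> norm x * norm y * K"
    using mul.pos_bounded by blast
  define r where "r = 1 / (norm b * K * K + 1)"
  have "norm b * K * K + 1 > 0"
    using \<open>K > 0\<close> by (simp add: add_nonneg_pos)
  then have "r > 0"
    by (simp add: r_def)
  have "x \<in> regular_elements mul e" if x: "x \<in> ball a r" for x
  proof -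
    have "y = 0" if "mul x y = 0" for y
    proof (rule ccontr)
      assume "y \<noteq> 0"
      have "mul (a - x) y = mul a y"
        using that by (simp add: mul.diff_left)
      then have "y = mul b (mul (a - x) y)"
        using b by (metis assoc comm unit)
      then have "norm y \<le> norm b * norm (mul (a - x) y) * K"
        using K[of b "mul (a - x) y"] by simp
      also have "\<dots> \<le> norm b * (norm (a - x) * norm y * K) * K"
        using K[of "a - x" y] \<open>K > 0\<close> by (intro mult_right_mono mult_left_mono) auto
      finally have "1 * norm y \<le> (norm (a - x) * (norm b * K * K)) * norm y"
        by (simp add: ac_simps)
      then have "1 \<le> norm (a - x) * (norm b * K * K)"
        using \<open>y \<noteq> 0\<close> by (simp only: mult_le_cancel_right) simp
      also have "\<dots> \<le> r * (norm b * K * K)"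
        using x \<open>K > 0\<close> by (intro mult_right_mono) (auto simp: dist_norm)
      also have "\<dots> < 1"
        using \<open>norm b * K * K + 1 > 0\<close> by (simp add: r_def)
      finally show False
        by simp
    qed
    moreover have "linear (mul x)"
      by (intro bounded_linear.linear mul.bounded_linear_right)
    ultimately have "surj (mul x)"
      using linear_injective_0 linear_injective_imp_surjective by blast
    then obtain y where "mul x y = e"
      by (metis surjD)
    then show ?thesis
      unfolding regular_elements_def by blast
  qed
  then show "\<exists>r>0. ball a r \<subseteq> regular_elements mul e"
    using \<open>r > 0\<close> by blast
qed

text \<open>
  Writing \<open>b\<close> and \<open>y\<close> for the inverses of \<open>a\<close> and \<open>x\<close>, one has \<open>y - b = y b (a - x)\<close>.  This bounds
  \<open>y\<close> for \<open>x\<close> near \<open>a\<close>, and substituting the identity into itself leaves the error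
  \<open>(y - b) b (a - x)\<close> of the linear approximation \<open>b b (a - x)\<close>, which is quadratic in \<open>x - a\<close>.
\<close>

lemma has_derivative_alg_inverse:
  assumes a: "a \<in> regular_elements mul e"
  defines "b \<equiv> alg_inverse mul e a"
  shows "(alg_inverse mul e has_derivative mul (- mul b b)) (at a)"
proof -
  let ?inv = "alg_inverse mul e"
  have b: "mul a b = e"
    unfolding b_def using a by (rule mul_alg_inverse)
  obtain K where "K > 0" and K: "\<And>x y. norm (mul x y) \<le> norm x * norm y * K"
    using mul.pos_bounded by blast
  have K3: "norm (mul x (mul y z)) \<le> norm x * (norm y * norm z * K) * K" for x y z
  proof -
    have "norm (mul x (mul y z)) \<le> norm x * norm (mul y z) * K"
      by (rule K)
    also have "\<dots> \<le> norm x * (norm y * norm z * K) * K"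
      using K[of y z] \<open>K > 0\<close> by (intro mult_right_mono mult_left_mono) auto
    finally show ?thesis .
  qed
  define B where "B = norm b * K * K + 1"
  have "B > 0"
    using \<open>K > 0\<close> by (simp add: B_def add_nonneg_pos)
  obtain r where "r > 0" and r: "ball a r \<subseteq> regular_elements mul e"
    using open_regular_elements a open_contains_ball by blast
  define C where "C = 2 * norm b * B * B"
  have quad: "norm (?inv x - ?inv a - mul (- mul b b) (x - a)) \<le> C * (norm (x - a))\<^sup>2"
    if x: "norm (x - a) < min r (1 / (2 * B))" for x
  proof -
    define y where "y = ?inv x"
    have "x \<in> ball a r"
      using x by (simp add: dist_norm norm_minus_commute)
    then have xy: "mul x y = e"
      unfolding y_def using r by (intro mul_alg_inverse) blast
    have diff: "y - b = mul y (mul b (a - x))"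
    proof -
      have "mul y (mul b a) = y" "mul y (mul b x) = b"
        using b xy by (metis assoc comm unit)+
      then show ?thesis
        by (simp add: mul.diff_right)
    qed
    have step: "norm (mul z (mul b (a - x))) \<le> norm z * (B * norm (x - a))" for z
    proof -
      have "norm (mul z (mul b (a - x))) \<le> norm z * ((norm b * K * K) * norm (x - a))"
        using K3[of z b "a - x"] by (simp add: ac_simps norm_minus_commute)
      also have "\<dots> \<le> norm z * (B * norm (x - a))"
        by (intro mult_left_mono mult_right_mono) (auto simp: B_def)
      finally show ?thesis .
    qed
    have "norm y \<le> norm b + norm (y - b)"
      using norm_triangle_ineq[of b "y - b"] by simp
    also have "norm (y - b) \<le> norm y * (B * norm (x - a))"
      unfolding diff by (rule step)
    also have "\<dots> \<le> norm y * (1 / 2)"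
      using x \<open>B > 0\<close> by (intro mult_left_mono) (auto simp: field_simps)
    finally have y: "norm y \<le> 2 * norm b"
      by simp
    have "mul (- mul b b) (x - a) = mul b (mul b (a - x))"
      by (metis assoc minus_diff_eq mul.minus_left mul.minus_right)
    then have "y - b - mul (- mul b b) (x - a) = mul (y - b) (mul b (a - x))"
      by (simp add: mul.diff_left flip: diff)
    also have "norm \<dots> \<le> norm (y - b) * (B * norm (x - a))"
      by (rule step)
    also have "\<dots> \<le> (norm y * (B * norm (x - a))) * (B * norm (x - a))"
      using step[of y] \<open>B > 0\<close> unfolding diff by (intro mult_right_mono) auto
    also have "\<dots> \<le> (2 * norm b * (B * norm (x - a))) * (B * norm (x - a))"
      using y \<open>B > 0\<close> by (intro mult_right_mono) auto
    also have "\<dots> = C * (norm (x - a))\<^sup>2"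
      by (simp add: C_def power2_eq_square)
    finally show ?thesis
      by (simp add: y_def b_def)
  qed
  show ?thesis
    unfolding has_derivative_at_alt
  proof (intro conjI allI impI)
    show "bounded_linear (mul (- mul b b))"
      by (rule mul.bounded_linear_right)
    fix \<epsilon> :: real assume "\<epsilon> > 0"
    have "C \<ge> 0"
      using \<open>B > 0\<close> by (simp add: C_def)
    define d where "d = min (min r (1 / (2 * B))) (\<epsilon> / (C + 1))"
    have "d > 0"
      using \<open>r > 0\<close> \<open>B > 0\<close> \<open>\<epsilon> > 0\<close> \<open>C \<ge> 0\<close> by (simp add: d_def)
    moreover have "norm (?inv x - ?inv a - mul (- mul b b) (x - a)) \<le> \<epsilon> * norm (x - a)"
      if x: "norm (x - a) < d" for x
    proof -
      have "C * norm (x - a) \<le> (C + 1) * (\<epsilon> / (C + 1))"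
        using x \<open>C \<ge> 0\<close> by (intro mult_mono) (auto simp: d_def)
      also have "\<dots> = \<epsilon>"
        using \<open>C \<ge> 0\<close> by simp
      finally have "C * norm (x - a) * norm (x - a) \<le> \<epsilon> * norm (x - a)"
        by (rule mult_right_mono) simp
      moreover have "norm (?inv x - ?inv a - mul (- mul b b) (x - a)) \<le> C * (norm (x - a))\<^sup>2"
        using x by (intro quad) (simp add: d_def)
      ultimately show ?thesis
        by (simp add: power2_eq_square mult.assoc)
    qed
    ultimately show "\<exists>d>0. \<forall>x. norm (x - a) < d \<longrightarrow>
        norm (?inv x - ?inv a - mul (- mul b b) (x - a)) \<le> \<epsilon> * norm (x - a)"
      by blast
  qed
qed

lemma algebrizable_on_has_derivative:
  assumes "algebrizable_on mul \<Omega> F"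
  obtains F' where "\<And>w. w \<in> \<Omega> \<Longrightarrow> (F has_derivative mul (F' w)) (at w)"
proof -
  obtain F' where "\<forall>w\<in>\<Omega>.
      ((\<lambda>\<xi>. norm (F (w + \<xi>) - F w - mul (F' w) \<xi>) / norm \<xi>) \<longlongrightarrow> 0) (at 0)"
    using assms unfolding algebrizable_on_def by blast
  then have "(F has_derivative mul (F' w)) (at w)" if "w \<in> \<Omega>" for w
    using that unfolding has_derivative_at by (simp add: mul.bounded_linear_right)
  then show thesis
    using that by blast
qed

lemma open_regular_domain:
  assumes "open \<Omega>" and F: "algebrizable_on mul \<Omega> F"
  shows "open (regular_domain mul e \<Omega> F)"
proof -
  obtain F' where F': "\<And>w. w \<in> \<Omega> \<Longrightarrow> (F has_derivative mul (F' w)) (at w)"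
    using algebrizable_on_has_derivative[OF F] by blast
  have "continuous_on \<Omega> F"
    using F' has_derivative_continuous by (intro continuous_at_imp_continuous_on) blast
  then have "open (\<Omega> \<inter> F -` regular_elements mul e)"
    using \<open>open \<Omega>\<close> open_regular_elements by (intro continuous_open_preimage)
  moreover have "\<Omega> \<inter> F -` regular_elements mul e = regular_domain mul e \<Omega> F"
    by (auto simp: regular_domain_def)
  ultimately show ?thesis
    by simp
qed

lemma alg_reciprocal_has_derivative:
  assumes F: "algebrizable_on mul \<Omega> F"
  obtains H' where "\<And>w. w \<in> regular_domain mul e \<Omega> F \<Longrightarrow>
    ((\<lambda>w. alg_inverse mul e (F w)) has_derivative mul (H' w)) (at w)"
proof -
  obtain F' where F': "\<And>w. w \<in> \<Omega> \<Longrightarrow> (F has_derivative mul (F' w)) (at w)"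
    using algebrizable_on_has_derivative[OF F] by blast
  define b where "b = (\<lambda>w. alg_inverse mul e (F w))"
  have deriv: "(b has_derivative mul (mul (- mul (b w) (b w)) (F' w))) (at w)"
    if w: "w \<in> regular_domain mul e \<Omega> F" for w
  proof -
    have "w \<in> \<Omega>" "F w \<in> regular_elements mul e"
      using w by (auto simp: regular_domain_def)
    from has_derivative_compose[OF F'[OF this(1)] has_derivative_alg_inverse[OF this(2)]]
    have "(b has_derivative (\<lambda>\<xi>. mul (- mul (b w) (b w)) (mul (F' w) \<xi>))) (at w)"
      by (simp add: b_def)
    then show ?thesis
      by (simp flip: assoc)
  qed
  show thesis
    by (rule that) (rule deriv[unfolded b_def])
qed

section \<open>The coordinate fields of a multiplication\<close>

text \<open>
  The vector that represents the linear functional \<open>\<lambda>v. mul x v $ k\<close>.  At \<open>x = e/F w\<close> it is the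
  field \<open>G k\<close> at \<open>w\<close>.
\<close>

definition coord_covector :: "3 \<Rightarrow> real^3 \<Rightarrow> real^3" where
  "coord_covector k x = (\<chi> j. mul x (axis j 1) $ k)"

lemma coord_covector_inner: "coord_covector k x \<bullet> v = mul x v $ k"
proof -
  have "mul x v = mul x (\<Sum>j\<in>UNIV. v $ j *\<^sub>R axis j 1)"
    by (simp add: basis_expansion flip: scalar_mult_eq_scaleR)
  also have "\<dots> = (\<Sum>j\<in>UNIV. v $ j *\<^sub>R mul x (axis j 1))"
    by (simp add: mul.sum_right mul.scaleR_right)
  finally show ?thesis
    by (simp add: inner_vec_def coord_covector_def mult.commute)
qed

lemma bounded_linear_coord_covector: "bounded_linear (coord_covector k)"
  by (auto simp: coord_covector_def linear_iff mul.add_left mul.scaleR_left vec_eq_iff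
      simp flip: linear_conv_bounded_linear)

lemma coord_covector_structure_constants:
  assumes c: "structure_constants mul c"
  shows "coord_covector k x = (\<Sum>j\<in>UNIV. \<Sum>i\<in>UNIV. (c i j k * x $ i) *\<^sub>R axis j 1)"
proof -
  have cij: "mul (axis i 1) (axis j 1) $ k = c i j k" for i j
    using c by (simp add: structure_constants_def axis_def if_distrib[of "\<lambda>x. _ * x"] cong: if_cong)
  have "mul x y $ k = (\<Sum>i\<in>UNIV. x $ i * mul (axis i 1) y $ k)" for y
  proof -
    have "mul x y = mul (\<Sum>i\<in>UNIV. x $ i *\<^sub>R axis i 1) y"
      by (simp add: basis_expansion flip: scalar_mult_eq_scaleR)
    also have "\<dots> = (\<Sum>i\<in>UNIV. x $ i *\<^sub>R mul (axis i 1) y)"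
      by (simp add: mul.sum_left mul.scaleR_left)
    finally show ?thesis
      by simp
  qed
  then have "coord_covector k x $ j = (\<Sum>i\<in>UNIV. c i j k * x $ i)" for j
    by (simp add: coord_covector_def cij mult.commute)
  then have "(\<Sum>j\<in>UNIV. \<Sum>i\<in>UNIV. (c i j k * x $ i) *\<^sub>R axis j 1) =
      (\<Sum>j\<in>UNIV. coord_covector k x $ j *\<^sub>R axis j (1::real))"
    by (simp flip: scaleR_sum_left)
  also have "\<dots> = coord_covector k x"
    by (simp add: basis_expansion flip: scalar_mult_eq_scaleR)
  finally show ?thesis
    by simp
qed

text \<open>
  The derivative of the field pairs with \<open>u\<close> and \<open>v\<close> to the \<open>k\<close>-th coordinate of the product
  \<open>H' w u v\<close>, so its symmetry is the commutativity and associativity of the algebra.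
\<close>

lemma coord_covector_locally_gradient:
  assumes "open S" and H: "\<And>w. w \<in> S \<Longrightarrow> (H has_derivative mul (H' w)) (at w)"
  shows "locally_gradient_on S (\<lambda>w. coord_covector k (H w))"
  unfolding locally_gradient_on_def
proof
  fix x assume "x \<in> S"
  then obtain r where "r > 0" and r: "ball x r \<subseteq> S"
    using \<open>open S\<close> open_contains_ball by blast
  have "\<exists>\<phi>. \<forall>y\<in>ball x r. GDERIV \<phi> y :> coord_covector k (H y)"
  proof (rule gradient_of_symmetric_derivative)
    fix w assume "w \<in> ball x r"
    then show "((\<lambda>w. coord_covector k (H w)) has_derivative
        (\<lambda>u. coord_covector k (mul (H' w) u))) (at w)"
      using r by (intro bounded_linear.has_derivative[OF bounded_linear_coord_covector] H) blast
    show "coord_covector k (mul (H' w) u) \<bullet> v = coord_covector k (mul (H' w) v) \<bullet> u" for u v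
      unfolding coord_covector_inner assoc by (subst comm[of u v]) (rule refl)
  qed auto
  then show "\<exists>r>0. \<exists>\<phi>. \<forall>y\<in>ball x r. GDERIV \<phi> y :> coord_covector k (H y)"
    using \<open>r > 0\<close> by blast
qed

end

theorem proposition3p1:
  fixes mul :: "real^3 \<Rightarrow> real^3 \<Rightarrow> real^3" and e :: "real^3"
    and c :: "3 \<Rightarrow> 3 \<Rightarrow> 3 \<Rightarrow> real"
    and \<Omega> :: "(real^3) set" and F :: "real^3 \<Rightarrow> real^3"
    and g :: "3 \<Rightarrow> real^3 \<Rightarrow> real"
    and G E :: "3 \<Rightarrow> real^3 \<Rightarrow> real^3"
  assumes alg: "r3_algebra mul e"
    and c: "structure_constants mul c"
    and \<Omega>: "open \<Omega>"
    and F: "algebrizable_on mul \<Omega> F"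
    and g: "\<forall>w \<in> regular_domain mul e \<Omega> F.
              vector [g 1 w, g 2 w, g 3 w] = alg_inverse mul e (F w)"
    and G: "\<forall>k. \<forall>w \<in> regular_domain mul e \<Omega> F.
              G k w = (\<Sum>j\<in>UNIV. \<Sum>i\<in>UNIV. (c i j k * g i w) *\<^sub>R axis j 1)"
    and E: "\<forall>i. \<forall>w \<in> \<Omega>. E i w = mul (axis i 1) (F w)"
  shows
    "(\<forall>a \<gamma>. 0 < a \<and> \<gamma> differentiable_on {0..a} \<and> \<gamma> ` {0..a} \<subseteq> regular_domain mul e \<Omega> F \<longrightarrow>
        alg_line_integrand mul (\<lambda>w. alg_inverse mul e (F w)) a \<gamma> integrable_on {0..a} \<and>
        (\<forall>k. line_integrand (G k) a \<gamma> integrable_on {0..a}) \<and>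
        alg_line_integral mul (\<lambda>w. alg_inverse mul e (F w)) a \<gamma> =
          vector [line_integral (G 1) a \<gamma>, line_integral (G 2) a \<gamma>, line_integral (G 3) a \<gamma>]) \<and>
     (\<forall>k. conservative_on (regular_domain mul e \<Omega> F) (G k)) \<and>
     (\<forall>k. \<forall>w \<in> regular_domain mul e \<Omega> F.
        G k w = vector [c 1 1 k * g 1 w + c 2 1 k * g 2 w + c 3 1 k * g 3 w,
                        c 1 2 k * g 1 w + c 2 2 k * g 2 w + c 3 2 k * g 3 w,
                        c 1 3 k * g 1 w + c 2 3 k * g 2 w + c 3 3 k * g 3 w]) \<and>
     (\<forall>i j. \<forall>w \<in> regular_domain mul e \<Omega> F.
        E i w \<bullet> G j w = (if i = j then 1 else 0))"
proof -
  interpret r3_algebra_product mul e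
    by unfold_locales (rule alg)
  define S where "S = regular_domain mul e \<Omega> F"
  define H where "H = (\<lambda>w. alg_inverse mul e (F w))"
  have "open S"
    unfolding S_def using \<Omega> F by (rule open_regular_domain)
  obtain H' where H': "\<And>w. w \<in> S \<Longrightarrow> (H has_derivative mul (H' w)) (at w)"
    using alg_reciprocal_has_derivative[OF F] unfolding S_def H_def by blast
  have gH: "g i w = H w $ i" if "w \<in> S" for i w
  proof -
    have "H w = vector [g 1 w, g 2 w, g 3 w]"
      using g that by (simp add: S_def H_def)
    then show ?thesis
      using exhaust_3[of i] by auto
  qed
  have G_covector: "G k w = coord_covector k (H w)" if "w \<in> S" for k w
    using G that by (simp add: S_def[symmetric] gH coord_covector_structure_constants[OF c])
  have G_inner: "G k w \<bullet> v = mul (H w) v $ k" if "w \<in> S" for k w v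
    using that by (simp add: G_covector coord_covector_inner)
  \<comment> \<open>\<open>G k\<close> is prescribed on the open set \<open>S\<close> only, hence the smaller ball.\<close>
  have loc: "locally_gradient_on S (G k)" for k
    unfolding locally_gradient_on_def
  proof
    fix x assume "x \<in> S"
    obtain r \<phi> where "r > 0" and \<phi>: "\<forall>y\<in>ball x r. GDERIV \<phi> y :> coord_covector k (H y)"
      using coord_covector_locally_gradient[OF \<open>open S\<close> H', of k] \<open>x \<in> S\<close>
      unfolding locally_gradient_on_def by blast
    obtain r' where "r' > 0" and r': "ball x r' \<subseteq> S"
      using \<open>open S\<close> \<open>x \<in> S\<close> open_contains_ball by blast
    have "\<forall>y\<in>ball x (min r r'). GDERIV \<phi> y :> G k y"
      using \<phi> r' by (auto simp: G_covector subset_iff)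
    then show "\<exists>r>0. \<exists>\<phi>. \<forall>y\<in>ball x r. GDERIV \<phi> y :> G k y"
      using \<open>r > 0\<close> \<open>r' > 0\<close> by (intro exI[of _ "min r r'"]) auto
  qed
  have "continuous_on S H"
    using H' has_derivative_continuous by (intro continuous_at_imp_continuous_on) blast
  then have contG: "continuous_on S (G k)" for k
    by (subst continuous_on_cong[OF refl G_covector])
      (auto intro: bounded_linear.continuous_on[OF bounded_linear_coord_covector])
  have integrals: "alg_line_integrand mul H a \<gamma> integrable_on {0..a} \<and>
      (\<forall>k. line_integrand (G k) a \<gamma> integrable_on {0..a}) \<and>
      alg_line_integral mul H a \<gamma> =
        vector [line_integral (G 1) a \<gamma>, line_integral (G 2) a \<gamma>, line_integral (G 3) a \<gamma>]"
    if \<gamma>: "\<gamma> differentiable_on {0..a}" "\<gamma> ` {0..a} \<subseteq> S" for a \<gamma>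
  proof -
    have int: "line_integrand (G k) a \<gamma> integrable_on {0..a}" for k
      using loc \<gamma> by (rule line_integrand_integrable)
    have comp: "alg_line_integrand mul H a \<gamma> t $ k = line_integrand (G k) a \<gamma> t"
      if "t \<in> {0..a}" for k t
      using that \<gamma>(2) by (simp add: alg_line_integrand_def line_integrand_def G_inner image_subset_iff)
    have int_alg: "alg_line_integrand mul H a \<gamma> integrable_on {0..a}"
    proof (rule integrable_componentwise)
      fix b :: "real^3" assume "b \<in> Basis"
      then obtain k where b: "b = axis k 1"
        by (auto simp: Basis_vec_def)
      show "(\<lambda>t. alg_line_integrand mul H a \<gamma> t \<bullet> b) integrable_on {0..a}"
        using int[of k] by (rule integrable_eq) (simp add: b inner_axis comp)
    qed
    have "alg_line_integral mul H a \<gamma> $ k = line_integral (G k) a \<gamma>" for k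
      unfolding alg_line_integral_def line_integral_def integral_component_eq_cart[OF int_alg, symmetric]
      by (intro integral_cong comp)
    then show ?thesis
      using int int_alg by (simp add: vec_eq_iff forall_3)
  qed
  have conservative: "conservative_on S (G k)" for k
    unfolding conservative_on_def gradient_field_on_def
  proof (intro allI impI)
    fix U assume U: "U \<subseteq> S \<and> open U \<and> simply_connected U"
    then have "locally_gradient_on U (G k)"
      using loc[of k] unfolding locally_gradient_on_def by blast
    then show "\<exists>\<phi>. \<forall>w\<in>U. GDERIV \<phi> w :> G k w"
      using U continuous_on_subset[OF contG] by (intro gradient_on_simply_connected) auto
  qed
  have explicit: "G k w = vector [c 1 1 k * g 1 w + c 2 1 k * g 2 w + c 3 1 k * g 3 w,
      c 1 2 k * g 1 w + c 2 2 k * g 2 w + c 3 2 k * g 3 w,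
      c 1 3 k * g 1 w + c 2 3 k * g 2 w + c 3 3 k * g 3 w]" if "w \<in> S" for k w
  proof -
    have "G k w = (\<Sum>j\<in>UNIV. \<Sum>i\<in>UNIV. (c i j k * g i w) *\<^sub>R axis j 1)"
      using G that by (simp add: S_def)
    then show ?thesis
      by (simp add: vec_eq_iff forall_3 sum_3 axis_def)
  qed
  have dual: "E i w \<bullet> G j w = (if i = j then 1 else 0)" if w: "w \<in> S" for i j w
  proof -
    have "E i w = mul (axis i 1) (F w)" "mul (F w) (H w) = e"
      using w E mul_alg_inverse by (auto simp: S_def H_def regular_domain_def)
    \<comment> \<open>\<open>G j w\<close> multiplies by \<open>e/F w\<close> and reads off coordinate \<open>j\<close>, while \<open>E i w = e\<^sub>i F w\<close>.\<close>
    then have "mul (H w) (E i w) = axis i 1"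
      by (metis assoc comm unit)
    then show ?thesis
      using G_inner[OF w, of j "E i w"] by (simp add: inner_commute axis_def)
  qed
  show ?thesis
    unfolding S_def[symmetric] H_def[symmetric]
  proof (intro conjI, goal_cases)
    case 1
    show ?case
      by (intro allI impI integrals) simp_all
  next
    case 2
    show ?case
      by (intro allI conservative)
  next
    case 3
    show ?case
      by (intro allI ballI explicit)
  next
    case 4
    show ?case
      by (intro allI ballI dual)
  qed
qed

end
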